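(* Consider the map $\rho\colon\Lambda(\mathsf{MGrz})\to\Lambda(\mathsf{MIPC})$ given by $\rho\mathsf M=\{\varphi:\mathsf M\vdash\varphi^t\}$. (1) $\rho\colon\Lambda(\mathsf{MGrz})\to\Lambda(\mathsf{MIPC})$ is not a lattice homomorphism. (2) $\rho\colon\Lambda(\mathsf{MGrz})\to\Lambda(\mathsf{MIPC})$ is not one-to-one.
   Context: $\mathcal L_{\forall\exists}$ is the propositional language with connectives $\bot,\wedge,\vee,\to$ (and $\neg\varphi=\varphi\to\bot$) and two unary modalities $\forall,\exists$. $\mathsf{MIPC}$ is the smallest set of $\mathcal L_{\forall\exists}$-formulas containing all theorems of the intuitionistic propositional calculus and the formulas $\forall(p\land q)\leftrightarrow(\forall p\land\forall q)$, $\forall p\to p$, $\forall p\to\forall\forall p$, $\exists(p\vee q)\leftrightarrow(\exists p\vee\exists q)$, $p\to\exists p$, $\exists\exists p\to\exists p$, $(\exists p\land\exists q)\to\exists(\exists p\land q)$, $\exists\forall p\leftrightarrow\forall p$, $\exists p\leftrightarrow\forall\exists p$, and closed under modus ponens, substitution, and necessitation $\varphi/\forall\varphi$. An extension of $\mathsf{MIPC}$ is a set of $\mathcal L_{\forall\exists}$-formulas containing $\mathsf{MIPC}$ and closed under the same rules. $\Lambda(\mathsf{MIPC})$ is the complete lattice of extensions of $\mathsf{MIPC}$ ordered by inclusion (meets are intersections; the join is the least extension containing the union). $\mathcal L_{\Box\forall}$ is the classical propositional modal language with two unary modalities $\Box,\forall$; $\exists$ abbreviates $\neg\forall\neg$.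 $\mathsf{MS4}$ is the smallest set of $\mathcal L_{\Box\forall}$-formulas containing all theorems of classical propositional calculus, the $\mathsf{S4}$-axioms for $\Box$, the $\mathsf{S5}$-axioms for $\forall$, the axiom $\Box\forall p\to\forall\Box p$, and closed under modus ponens, substitution, $\Box$-necessitation and $\forall$-necessitation. Extensions of $\mathsf{MS4}$ are sets of $\mathcal L_{\Box\forall}$-formulas containing $\mathsf{MS4}$ and closed under these rules; $\mathsf M+\Gamma$ is the least extension containing $\mathsf M\cup\Gamma$. $\mathsf{MGrz}=\mathsf{MS4}+\{\Box(\Box(p\to\Box p)\to p)\to p\}$, and $\Lambda(\mathsf{MGrz})$ is the complete lattice (under inclusion) of extensions of $\mathsf{MS4}$ containing $\mathsf{MGrz}$. $\mathsf M\vdash\varphi$ means $\varphi\in\mathsf M$. The Gödel translation $(-)^t$ from $\mathcal L_{\forall\exists}$-formulas to $\mathcal L_{\Box\forall}$-formulas: $\bot^t=\bot$, $p^t=\Box p$ for propositional letters $p$, $(\varphi\land\psi)^t=\varphi^t\land\psi^t$, $(\varphi\lor\psi)^t=\varphi^t\lor\psi^t$, $(\varphi\to\psi)^t=\Box(\neg\varphi^t\lor\psi^t)$, $(\forall\varphi)^t=\Box\forall\varphi^t$, $(\exists\varphi)^t=\exists\varphi^t$. In $\rho\mathsf M$, $\varphi$ ranges over $\mathcal L_{\forall\exists}$-formulas. *)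

theory Defs
  imports "HOL-Algebra.Complete_Lattice"
begin

section \<open>Propositional formulas; the calculi IPC and CPC\<close>

datatype pfm =
    PVar nat
  | PBot                (\<open>\<bottom>\<^sub>P\<close>)
  | PAnd pfm pfm        (infixr \<open>\<and>\<^sub>P\<close> 75)
  | POr pfm pfm         (infixr \<open>\<or>\<^sub>P\<close> 70)
  | PImp pfm pfm        (infixr \<open>\<rightarrow>\<^sub>P\<close> 65)

inductive_set IPC :: "pfm set" where
  K: "A \<rightarrow>\<^sub>P B \<rightarrow>\<^sub>P A \<in> IPC"
| S: "(A \<rightarrow>\<^sub>P B \<rightarrow>\<^sub>P C) \<rightarrow>\<^sub>P (A \<rightarrow>\<^sub>P B) \<rightarrow>\<^sub>P A \<rightarrow>\<^sub>P C \<in> IPC"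
| conjE1: "A \<and>\<^sub>P B \<rightarrow>\<^sub>P A \<in> IPC"
| conjE2: "A \<and>\<^sub>P B \<rightarrow>\<^sub>P B \<in> IPC"
| conjI: "A \<rightarrow>\<^sub>P B \<rightarrow>\<^sub>P A \<and>\<^sub>P B \<in> IPC"
| disjI1: "A \<rightarrow>\<^sub>P A \<or>\<^sub>P B \<in> IPC"
| disjI2: "B \<rightarrow>\<^sub>P A \<or>\<^sub>P B \<in> IPC"
| disjE: "(A \<rightarrow>\<^sub>P C) \<rightarrow>\<^sub>P (B \<rightarrow>\<^sub>P C) \<rightarrow>\<^sub>P A \<or>\<^sub>P B \<rightarrow>\<^sub>P C \<in> IPC"
| botE: "\<bottom>\<^sub>P \<rightarrow>\<^sub>P A \<in> IPC"
| mp: "A \<rightarrow>\<^sub>P B \<in> IPC \<Longrightarrow> A \<in> IPC \<Longrightarrow> B \<in> IPC"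

inductive_set CPC :: "pfm set" where
  ipc: "A \<in> IPC \<Longrightarrow> A \<in> CPC"
| dneg: "((A \<rightarrow>\<^sub>P \<bottom>\<^sub>P) \<rightarrow>\<^sub>P \<bottom>\<^sub>P) \<rightarrow>\<^sub>P A \<in> CPC"
| mp: "A \<rightarrow>\<^sub>P B \<in> CPC \<Longrightarrow> A \<in> CPC \<Longrightarrow> B \<in> CPC"

section \<open>The intuitionistic language and the lattice of extensions of MIPC\<close>

datatype ifm =
    IVar nat
  | IBot                (\<open>\<bottom>\<^sub>I\<close>)
  | IAnd ifm ifm        (infixr \<open>\<and>\<^sub>I\<close> 75)
  | IOr ifm ifm         (infixr \<open>\<or>\<^sub>I\<close> 70)
  | IImp ifm ifm        (infixr \<open>\<rightarrow>\<^sub>I\<close> 65)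
  | IAll ifm            (\<open>\<forall>\<^sub>I _\<close> [80] 80)
  | IEx ifm             (\<open>\<exists>\<^sub>I _\<close> [80] 80)

abbreviation IIff :: "ifm \<Rightarrow> ifm \<Rightarrow> ifm"  (infix \<open>\<leftrightarrow>\<^sub>I\<close> 60) where
  "A \<leftrightarrow>\<^sub>I B \<equiv> (A \<rightarrow>\<^sub>I B) \<and>\<^sub>I (B \<rightarrow>\<^sub>I A)"

primrec ifm_of_pfm :: "pfm \<Rightarrow> ifm" where
  "ifm_of_pfm (PVar n) = IVar n"
| "ifm_of_pfm \<bottom>\<^sub>P = \<bottom>\<^sub>I"
| "ifm_of_pfm (A \<and>\<^sub>P B) = ifm_of_pfm A \<and>\<^sub>I ifm_of_pfm B"
| "ifm_of_pfm (A \<or>\<^sub>P B) = ifm_of_pfm A \<or>\<^sub>I ifm_of_pfm B"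
| "ifm_of_pfm (A \<rightarrow>\<^sub>P B) = ifm_of_pfm A \<rightarrow>\<^sub>I ifm_of_pfm B"

primrec isubst :: "(nat \<Rightarrow> ifm) \<Rightarrow> ifm \<Rightarrow> ifm" where
  "isubst \<sigma> (IVar n) = \<sigma> n"
| "isubst \<sigma> \<bottom>\<^sub>I = \<bottom>\<^sub>I"
| "isubst \<sigma> (A \<and>\<^sub>I B) = isubst \<sigma> A \<and>\<^sub>I isubst \<sigma> B"
| "isubst \<sigma> (A \<or>\<^sub>I B) = isubst \<sigma> A \<or>\<^sub>I isubst \<sigma> B"
| "isubst \<sigma> (A \<rightarrow>\<^sub>I B) = isubst \<sigma> A \<rightarrow>\<^sub>I isubst \<sigma> B"
| "isubst \<sigma> (\<forall>\<^sub>I A) = \<forall>\<^sub>I (isubst \<sigma> A)"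
| "isubst \<sigma> (\<exists>\<^sub>I A) = \<exists>\<^sub>I (isubst \<sigma> A)"

definition MIPC_axioms :: "ifm set" where
  "MIPC_axioms = (let p = IVar 0; q = IVar 1 in
    { \<forall>\<^sub>I (p \<and>\<^sub>I q) \<leftrightarrow>\<^sub>I (\<forall>\<^sub>I p \<and>\<^sub>I \<forall>\<^sub>I q),
      \<forall>\<^sub>I p \<rightarrow>\<^sub>I p,
      \<forall>\<^sub>I p \<rightarrow>\<^sub>I \<forall>\<^sub>I (\<forall>\<^sub>I p),
      \<exists>\<^sub>I (p \<or>\<^sub>I q) \<leftrightarrow>\<^sub>I (\<exists>\<^sub>I p \<or>\<^sub>I \<exists>\<^sub>I q),
      p \<rightarrow>\<^sub>I \<exists>\<^sub>I p,
      \<exists>\<^sub>I (\<exists>\<^sub>I p) \<rightarrow>\<^sub>I \<exists>\<^sub>I p,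
      (\<exists>\<^sub>I p \<and>\<^sub>I \<exists>\<^sub>I q) \<rightarrow>\<^sub>I \<exists>\<^sub>I (\<exists>\<^sub>I p \<and>\<^sub>I q),
      \<exists>\<^sub>I (\<forall>\<^sub>I p) \<leftrightarrow>\<^sub>I \<forall>\<^sub>I p,
      \<exists>\<^sub>I p \<leftrightarrow>\<^sub>I \<forall>\<^sub>I (\<exists>\<^sub>I p) })"

definition irule_closed :: "ifm set \<Rightarrow> bool" where
  "irule_closed L \<longleftrightarrow>
     (\<forall>A B. A \<in> L \<longrightarrow> (A \<rightarrow>\<^sub>I B) \<in> L \<longrightarrow> B \<in> L) \<and>
     (\<forall>A \<sigma>. A \<in> L \<longrightarrow> isubst \<sigma> A \<in> L) \<and>
     (\<forall>A. A \<in> L \<longrightarrow> \<forall>\<^sub>I A \<in> L)"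

definition MIPC :: "ifm set" where
  "MIPC = \<Inter> {L. ifm_of_pfm ` IPC \<subseteq> L \<and> MIPC_axioms \<subseteq> L \<and> irule_closed L}"

definition Lambda_MIPC :: "ifm set gorder"  (\<open>\<Lambda>MIPC\<close>) where
  "\<Lambda>MIPC = \<lparr>carrier = {L. MIPC \<subseteq> L \<and> irule_closed L}, eq = (=), le = (\<subseteq>)\<rparr>"


section \<open>The classical bimodal language and the lattice of extensions of MGrz\<close>

datatype mfm =
    MVar nat
  | MBot                (\<open>\<bottom>\<^sub>M\<close>)
  | MAnd mfm mfm        (infixr \<open>\<and>\<^sub>M\<close> 75)
  | MOr mfm mfm         (infixr \<open>\<or>\<^sub>M\<close> 70)
  | MImp mfm mfm        (infixr \<open>\<rightarrow>\<^sub>M\<close> 65)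
  | MBox mfm            (\<open>\<box>\<^sub>M _\<close> [80] 80)
  | MAll mfm            (\<open>\<forall>\<^sub>M _\<close> [80] 80)

abbreviation MNot :: "mfm \<Rightarrow> mfm"  (\<open>\<not>\<^sub>M _\<close> [80] 80) where
  "\<not>\<^sub>M A \<equiv> A \<rightarrow>\<^sub>M \<bottom>\<^sub>M"

abbreviation MEx :: "mfm \<Rightarrow> mfm"  (\<open>\<exists>\<^sub>M _\<close> [80] 80) where
  "\<exists>\<^sub>M A \<equiv> \<not>\<^sub>M (\<forall>\<^sub>M (\<not>\<^sub>M A))"

primrec mfm_of_pfm :: "pfm \<Rightarrow> mfm" where
  "mfm_of_pfm (PVar n) = MVar n"
| "mfm_of_pfm \<bottom>\<^sub>P = \<bottom>\<^sub>M"
| "mfm_of_pfm (A \<and>\<^sub>P B) = mfm_of_pfm A \<and>\<^sub>M mfm_of_pfm B"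
| "mfm_of_pfm (A \<or>\<^sub>P B) = mfm_of_pfm A \<or>\<^sub>M mfm_of_pfm B"
| "mfm_of_pfm (A \<rightarrow>\<^sub>P B) = mfm_of_pfm A \<rightarrow>\<^sub>M mfm_of_pfm B"

primrec msubst :: "(nat \<Rightarrow> mfm) \<Rightarrow> mfm \<Rightarrow> mfm" where
  "msubst \<sigma> (MVar n) = \<sigma> n"
| "msubst \<sigma> \<bottom>\<^sub>M = \<bottom>\<^sub>M"
| "msubst \<sigma> (A \<and>\<^sub>M B) = msubst \<sigma> A \<and>\<^sub>M msubst \<sigma> B"
| "msubst \<sigma> (A \<or>\<^sub>M B) = msubst \<sigma> A \<or>\<^sub>M msubst \<sigma> B"
| "msubst \<sigma> (A \<rightarrow>\<^sub>M B) = msubst \<sigma> A \<rightarrow>\<^sub>M msubst \<sigma> B"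
| "msubst \<sigma> (\<box>\<^sub>M A) = \<box>\<^sub>M (msubst \<sigma> A)"
| "msubst \<sigma> (\<forall>\<^sub>M A) = \<forall>\<^sub>M (msubst \<sigma> A)"

definition S4_axioms :: "mfm set" where
  "S4_axioms = (let p = MVar 0; q = MVar 1 in
    { \<box>\<^sub>M (p \<rightarrow>\<^sub>M q) \<rightarrow>\<^sub>M \<box>\<^sub>M p \<rightarrow>\<^sub>M \<box>\<^sub>M q,
      \<box>\<^sub>M p \<rightarrow>\<^sub>M p,
      \<box>\<^sub>M p \<rightarrow>\<^sub>M \<box>\<^sub>M (\<box>\<^sub>M p) })"

definition S5_axioms :: "mfm set" where
  "S5_axioms = (let p = MVar 0; q = MVar 1 in
    { \<forall>\<^sub>M (p \<rightarrow>\<^sub>M q) \<rightarrow>\<^sub>M \<forall>\<^sub>M p \<rightarrow>\<^sub>M \<forall>\<^sub>M q,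
      \<forall>\<^sub>M p \<rightarrow>\<^sub>M p,
      \<forall>\<^sub>M p \<rightarrow>\<^sub>M \<forall>\<^sub>M (\<forall>\<^sub>M p),
      \<exists>\<^sub>M p \<rightarrow>\<^sub>M \<forall>\<^sub>M (\<exists>\<^sub>M p) })"

definition MS4_axioms :: "mfm set" where
  "MS4_axioms = S4_axioms \<union> S5_axioms \<union>
     { \<box>\<^sub>M (\<forall>\<^sub>M (MVar 0)) \<rightarrow>\<^sub>M \<forall>\<^sub>M (\<box>\<^sub>M (MVar 0)) }"

definition mrule_closed :: "mfm set \<Rightarrow> bool" where
  "mrule_closed L \<longleftrightarrow>
     (\<forall>A B. A \<in> L \<longrightarrow> (A \<rightarrow>\<^sub>M B) \<in> L \<longrightarrow> B \<in> L) \<and>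
     (\<forall>A \<sigma>. A \<in> L \<longrightarrow> msubst \<sigma> A \<in> L) \<and>
     (\<forall>A. A \<in> L \<longrightarrow> \<box>\<^sub>M A \<in> L) \<and>
     (\<forall>A. A \<in> L \<longrightarrow> \<forall>\<^sub>M A \<in> L)"

definition MS4 :: "mfm set" where
  "MS4 = \<Inter> {L. mfm_of_pfm ` CPC \<subseteq> L \<and> MS4_axioms \<subseteq> L \<and> mrule_closed L}"

definition MS4_extension :: "mfm set \<Rightarrow> bool" where
  "MS4_extension L \<longleftrightarrow> MS4 \<subseteq> L \<and> mrule_closed L"

definition extend_by :: "mfm set \<Rightarrow> mfm set \<Rightarrow> mfm set"  (infixl \<open>+\<^sub>M\<close> 65) where
  "M +\<^sub>M \<Gamma> = \<Inter> {L. MS4_extension L \<and> M \<union> \<Gamma> \<subseteq> L}"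

definition grz :: mfm where
  "grz = (let p = MVar 0 in \<box>\<^sub>M (\<box>\<^sub>M (p \<rightarrow>\<^sub>M \<box>\<^sub>M p) \<rightarrow>\<^sub>M p) \<rightarrow>\<^sub>M p)"

definition MGrz :: "mfm set" where
  "MGrz = MS4 +\<^sub>M {grz}"

definition Lambda_MGrz :: "mfm set gorder"  (\<open>\<Lambda>MGrz\<close>) where
  "\<Lambda>MGrz = \<lparr>carrier = {L. MS4_extension L \<and> MGrz \<subseteq> L}, eq = (=), le = (\<subseteq>)\<rparr>"


section \<open>The Goedel translation and the map rho\<close>

primrec goedel :: "ifm \<Rightarrow> mfm" where
  "goedel (IVar n) = \<box>\<^sub>M (MVar n)"
| "goedel \<bottom>\<^sub>I = \<bottom>\<^sub>M"
| "goedel (A \<and>\<^sub>I B) = goedel A \<and>\<^sub>M goedel B"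
| "goedel (A \<or>\<^sub>I B) = goedel A \<or>\<^sub>M goedel B"
| "goedel (A \<rightarrow>\<^sub>I B) = \<box>\<^sub>M (\<not>\<^sub>M (goedel A) \<or>\<^sub>M goedel B)"
| "goedel (\<forall>\<^sub>I A) = \<box>\<^sub>M (\<forall>\<^sub>M (goedel A))"
| "goedel (\<exists>\<^sub>I A) = \<exists>\<^sub>M (goedel A)"

definition rho :: "mfm set \<Rightarrow> ifm set"  (\<open>\<rho>\<close>) where
  "\<rho> M = {A. goedel A \<in> M}"


section \<open>Lattice homomorphisms\<close>

text \<open>
  \<^const>\<open>join_pres\<close> and \<^const>\<open>meet_pres\<close> also demand that both orders be lattices, so a map between
  non-lattices would vacuously fail to be a homomorphism. The two completeness lemmas below
  exclude this reading for the orders considered here.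
\<close>

definition lattice_hom :: "('a, 'c) gorder_scheme \<Rightarrow> ('b, 'd) gorder_scheme \<Rightarrow> ('a \<Rightarrow> 'b) set" where
  "lattice_hom X Y = {f \<in> carrier X \<rightarrow> carrier Y. join_pres X Y f \<and> meet_pres X Y f}"

lemma complete_lattice_closure_system:
  assumes "\<And>S. S \<subseteq> C \<Longrightarrow> \<Inter> S \<in> C"
  shows "complete_lattice \<lparr>carrier = C, eq = (=), le = (\<subseteq>)\<rparr>" (is "complete_lattice ?L")
proof -
  interpret partial_order ?L
    by standard auto
  show ?thesis
  proof (rule complete_lattice_criterion1)
    have "UNIV \<in> C"
      using assms[of "{}"] by simp
    then show "\<exists>g. greatest ?L g (carrier ?L)"
      by (auto simp: greatest_def)
  next
    fix S
    assume "S \<subseteq> carrier ?L"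
    then have "greatest ?L (\<Inter> S) (Lower ?L S)"
      using assms[of S] by (auto simp: greatest_def Lower_def)
    then show "\<exists>i. greatest ?L i (Lower ?L S)" ..
  qed
qed

lemma complete_lattice_Lambda_MIPC: "complete_lattice \<Lambda>MIPC"
  unfolding Lambda_MIPC_def
proof (rule complete_lattice_closure_system)
  fix S assume S: "S \<subseteq> {L. MIPC \<subseteq> L \<and> irule_closed L}"
  have "MIPC \<subseteq> \<Inter> S"
    using S by (intro Inter_greatest) auto
  moreover have "\<forall>L\<in>S. irule_closed L"
    using S by auto
  then have "irule_closed (\<Inter> S)"
    unfolding irule_closed_def Inter_iff by meson
  ultimately show "\<Inter> S \<in> {L. MIPC \<subseteq> L \<and> irule_closed L}" by simp
qed

lemma complete_lattice_Lambda_MGrz: "complete_lattice \<Lambda>MGrz"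
  unfolding Lambda_MGrz_def
proof (rule complete_lattice_closure_system)
  fix S assume S: "S \<subseteq> {L. MS4_extension L \<and> MGrz \<subseteq> L}"
  have "MGrz \<subseteq> \<Inter> S" "MS4 \<subseteq> \<Inter> S"
    using S by (auto simp: MS4_extension_def intro!: Inter_greatest)
  moreover have "\<forall>L\<in>S. mrule_closed L"
    using S by (auto simp: MS4_extension_def)
  then have "mrule_closed (\<Inter> S)"
    unfolding mrule_closed_def Inter_iff by meson
  ultimately show "\<Inter> S \<in> {L. MS4_extension L \<and> MGrz \<subseteq> L}"
    by (simp add: MS4_extension_def)
qed

end

theory Submission
  imports Defs
begin

text \<open>
  The Goedel translation sees the modality \<open>\<forall>\<close> of a Kripke frame \<open>(W, R, E)\<close> for MS4 only
  through the combination \<open>\<box>\<forall>\<close>, that is, through the composite relation \<open>R ; E\<close>, and it sees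
  \<open>\<exists>\<close> only on sets closed upwards under \<open>R\<close>. A map between frames can therefore be a bounded
  morphism for \<open>R\<close> and respect everything that translated formulas express although it is not
  a bounded morphism for \<open>E\<close>: the image of an \<open>E\<close>-class need only be cofinal in an \<open>E\<close>-class,
  provided that the missing points are found further up (lemma \<open>goedel_reflect\<close>). This is
  what breaks the Blok-Esakia correspondence between intuitionistic and modal logics here.

  Two finite posets show it. The chain has points \<open>CRoot < CMid < CTop\<close> and the two upper points
  form one \<open>E\<close>-class. The diamond has an additional point \<open>DSide\<close> between \<open>DRoot\<close> and \<open>DTop\<close>,
  incomparable with \<open>DMid\<close>, and \<open>DSide\<close> is an \<open>E\<close>-class of its own. Identifying \<open>DSide\<close> with
  \<open>DTop\<close> is a map from the diamond onto the chain of the kind just described, so that the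
  logic \<open>M\<close> of the diamond and the logic \<open>N\<close> of the chain satisfy \<open>\<rho> M \<subseteq> \<rho> N\<close>
  (\<open>rho_diamond_le_rho_chain\<close>). Nevertheless \<open>M\<close> is not contained in \<open>N\<close>: a formula
  describing the chain from its root, \<open>chain_diagram\<close>, cannot be satisfied in the diamond, where
  every attempt is spoilt by the singleton class of \<open>DSide\<close>.

  Injectivity fails since \<open>M \<inter> N \<noteq> M\<close>, but \<open>\<rho> (M \<inter> N) = \<rho> M \<inter> \<rho> N = \<rho> M\<close>.
  Joins are not preserved either. The join of \<open>\<rho> M\<close> and \<open>\<rho> N\<close> is \<open>\<rho> N\<close>, which does not
  contain the formula \<open>depth2\<close> that bounds the depth of a frame by two, because the chain has
  depth three. But the join of \<open>M\<close> and \<open>N\<close> proves its translation: a failure of \<open>depth2\<close> in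
  the chain singles out its three points and hence satisfies a substitution instance of
  \<open>chain_diagram\<close>, and \<open>M\<close> refutes all of these.

  It remains to see that \<open>\<rho>\<close> takes values in the extensions of MIPC. The translations of the
  theorems of MIPC are valid in all Kripke frames for MS4, and so are the equivalences needed for
  closure under substitution; by completeness of MS4 (\<open>MS4_complete\<close>, through the canonical
  model) they are theorems of MS4.
\<close>

section \<open>Kripke frames for MS4\<close>

primrec sat :: "('w \<Rightarrow> 'w \<Rightarrow> bool) \<Rightarrow> ('w \<Rightarrow> 'w \<Rightarrow> bool) \<Rightarrow> ('w \<Rightarrow> nat \<Rightarrow> bool) \<Rightarrow> mfm \<Rightarrow> 'w \<Rightarrow> bool"
  where
  "sat R E V (MVar n) w \<longleftrightarrow> V w n"
| "sat R E V \<bottom>\<^sub>M w \<longleftrightarrow> False"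
| "sat R E V (A \<and>\<^sub>M B) w \<longleftrightarrow> sat R E V A w \<and> sat R E V B w"
| "sat R E V (A \<or>\<^sub>M B) w \<longleftrightarrow> sat R E V A w \<or> sat R E V B w"
| "sat R E V (A \<rightarrow>\<^sub>M B) w \<longleftrightarrow> (sat R E V A w \<longrightarrow> sat R E V B w)"
| "sat R E V (\<box>\<^sub>M A) w \<longleftrightarrow> (\<forall>u. R w u \<longrightarrow> sat R E V A u)"
| "sat R E V (\<forall>\<^sub>M A) w \<longleftrightarrow> (\<forall>u. E w u \<longrightarrow> sat R E V A u)"

definition frame_logic :: "'w set \<Rightarrow> ('w \<Rightarrow> 'w \<Rightarrow> bool) \<Rightarrow> ('w \<Rightarrow> 'w \<Rightarrow> bool) \<Rightarrow> mfm set" where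
  "frame_logic W R E = {A. \<forall>V. \<forall>w\<in>W. sat R E V A w}"

locale MS4_frame =
  fixes W :: "'w set" and R E :: "'w \<Rightarrow> 'w \<Rightarrow> bool"
  assumes R_closed: "w \<in> W \<Longrightarrow> R w u \<Longrightarrow> u \<in> W"
    and E_closed: "w \<in> W \<Longrightarrow> E w u \<Longrightarrow> u \<in> W"
    and R_refl: "w \<in> W \<Longrightarrow> R w w"
    and R_trans: "w \<in> W \<Longrightarrow> R w u \<Longrightarrow> R u v \<Longrightarrow> R w v"
    and E_refl: "w \<in> W \<Longrightarrow> E w w"
    and E_sym: "w \<in> W \<Longrightarrow> E w u \<Longrightarrow> E u w"
    and E_trans: "w \<in> W \<Longrightarrow> E w u \<Longrightarrow> E u v \<Longrightarrow> E w v"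
    and commute: "w \<in> W \<Longrightarrow> E w u \<Longrightarrow> R u v \<Longrightarrow> \<exists>x. R w x \<and> E x v"

lemma mrule_closedD:
  assumes "mrule_closed L"
  shows "A \<in> L \<Longrightarrow> A \<rightarrow>\<^sub>M B \<in> L \<Longrightarrow> B \<in> L"
    and "A \<in> L \<Longrightarrow> msubst \<sigma> A \<in> L"
    and "A \<in> L \<Longrightarrow> \<box>\<^sub>M A \<in> L"
    and "A \<in> L \<Longrightarrow> \<forall>\<^sub>M A \<in> L"
  using assms unfolding mrule_closed_def by blast+

lemma mrule_closed_Inter: "(\<And>L. L \<in> S \<Longrightarrow> mrule_closed L) \<Longrightarrow> mrule_closed (\<Inter> S)"
  unfolding mrule_closed_def Inter_iff by meson

lemma sat_msubst:
  "sat R E V (msubst \<sigma> A) w \<longleftrightarrow> sat R E (\<lambda>w n. sat R E V (\<sigma> n) w) A w"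
  by (induction A arbitrary: w) auto

lemma IPC_sound: "A \<in> IPC \<Longrightarrow> sat R E V (mfm_of_pfm A) w"
  by (induction rule: IPC.induct) auto

lemma CPC_sound: "A \<in> CPC \<Longrightarrow> sat R E V (mfm_of_pfm A) w"
  by (induction rule: CPC.induct) (auto simp: IPC_sound)

context MS4_frame
begin

lemma MS4_extension_frame_logic: "MS4_extension (frame_logic W R E)"
proof -
  have "mfm_of_pfm ` CPC \<subseteq> frame_logic W R E"
    using CPC_sound by (fastforce simp: frame_logic_def)
  moreover have "S4_axioms \<subseteq> frame_logic W R E"
    by (auto simp: S4_axioms_def Let_def frame_logic_def dest: R_refl R_trans)
  moreover have "S5_axioms \<subseteq> frame_logic W R E"
  proof -
    have "V v 0" if "w \<in> W" "\<forall>v. E w v \<longrightarrow> V v 0" "E w u" "E u v"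
      for V :: "'w \<Rightarrow> nat \<Rightarrow> bool" and w u v
      using that E_trans by blast
    moreover have "\<exists>v. E u v \<and> V v 0" if "w \<in> W" "E w u" "E w v" "V v 0"
      for V :: "'w \<Rightarrow> nat \<Rightarrow> bool" and w u v
      using that E_sym E_trans E_closed by meson
    ultimately show ?thesis
      unfolding S5_axioms_def Let_def frame_logic_def by (auto dest: E_refl)
  qed
  moreover have "\<box>\<^sub>M (\<forall>\<^sub>M (MVar 0)) \<rightarrow>\<^sub>M \<forall>\<^sub>M (\<box>\<^sub>M (MVar 0)) \<in> frame_logic W R E"
    using commute by (fastforce simp: frame_logic_def)
  moreover have "mrule_closed (frame_logic W R E)"
    unfolding mrule_closed_def frame_logic_def
    by (auto simp: sat_msubst dest: R_closed E_closed)
  ultimately show ?thesis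
    unfolding MS4_extension_def MS4_def MS4_axioms_def by (simp add: Inter_lower)
qed

text \<open>
  If \<open>p\<close> fails at a point, finiteness gives a maximal point \<open>u\<close> above it where \<open>p\<close> fails. By
  maximality \<open>p\<close> holds everywhere strictly above \<open>u\<close>, so \<open>\<box>(p \<rightarrow> \<box>p)\<close> holds at \<open>u\<close>, and the
  premise of the Grzegorczyk axiom forces \<open>p\<close> there.
\<close>
lemma grz_valid_on_finite_poset:
  assumes "finite W" and antisym: "\<And>u v. u \<in> W \<Longrightarrow> R u v \<Longrightarrow> R v u \<Longrightarrow> u = v"
  shows "grz \<in> frame_logic W R E"
proof -
  have "V w 0" if w: "w \<in> W"
    and box: "\<forall>u. R w u \<longrightarrow> (\<forall>v. R u v \<longrightarrow> V v 0 \<longrightarrow> (\<forall>x. R v x \<longrightarrow> V x 0)) \<longrightarrow> V u 0"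
    for V :: "'w \<Rightarrow> nat \<Rightarrow> bool" and w
  proof (rule ccontr)
    assume "\<not> V w 0"
    define B where "B = {u \<in> W. R w u \<and> \<not> V u 0}"
    have "finite B" "w \<in> B" using assms(1) w R_refl \<open>\<not> V w 0\<close> by (auto simp: B_def)
    have "transp_on B (\<lambda>u v. R u v \<and> u \<noteq> v)"
    proof (rule transp_onI)
      fix u v x assume "u \<in> B" "R u v \<and> u \<noteq> v" "R v x \<and> v \<noteq> x"
      then show "R u x \<and> u \<noteq> x"
        using R_trans[of u v x] antisym[of u v] by (auto simp: B_def)
    qed
    moreover have "asymp_on B (\<lambda>u v. R u v \<and> u \<noteq> v)"
      using antisym by (auto simp: asymp_on_def B_def)
    ultimately have "\<exists>u\<in>B. \<forall>v\<in>B. R u v \<longrightarrow> u = v"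
      using Finite_Set.bex_max_element[of B "\<lambda>u v. R u v \<and> u \<noteq> v"] \<open>finite B\<close> \<open>w \<in> B\<close>
      by (metis empty_iff)
    then obtain u where u: "u \<in> B" "\<And>v. v \<in> B \<Longrightarrow> R u v \<Longrightarrow> u = v" by blast
    have "\<forall>v. R u v \<longrightarrow> V v 0 \<longrightarrow> (\<forall>x. R v x \<longrightarrow> V x 0)"
    proof (intro allI impI, rule ccontr)
      fix v x assume "R u v" "V v 0" "R v x" "\<not> V x 0"
      then have "x \<in> B" "R u x"
        using u(1) w R_trans[of w u v] R_trans[of w v x] R_trans[of u v x] R_closed[of w x]
        by (auto simp: B_def)
      then have "u = x" using u(2) by blast
      then have "u = v" using antisym u(1) \<open>R u v\<close> \<open>R v x\<close> by (auto simp: B_def)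
      then show False using \<open>V v 0\<close> u(1) by (auto simp: B_def)
    qed
    then show False using box u(1) by (auto simp: B_def)
  qed
  then show ?thesis
    by (auto simp: grz_def frame_logic_def Let_def)
qed

lemma frame_logic_in_Lambda_MGrz:
  assumes "finite W" and "\<And>u v. u \<in> W \<Longrightarrow> R u v \<Longrightarrow> R v u \<Longrightarrow> u = v"
  shows "frame_logic W R E \<in> carrier \<Lambda>MGrz"
proof -
  have "frame_logic W R E \<in> {L. MS4_extension L \<and> MS4 \<union> {grz} \<subseteq> L}"
    using MS4_extension_frame_logic grz_valid_on_finite_poset[OF assms]
    by (simp add: MS4_extension_def)
  then show ?thesis
    by (simp add: Lambda_MGrz_def MGrz_def extend_by_def Inter_lower)
qed

end

section \<open>Completeness of MS4\<close>

lemma MS4_contains: "mfm_of_pfm ` CPC \<subseteq> MS4" "MS4_axioms \<subseteq> MS4"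
  unfolding MS4_def by auto

lemma mrule_closed_MS4: "mrule_closed MS4"
  unfolding MS4_def by (rule mrule_closed_Inter) simp

lemma MS4_subst: "A \<in> MS4 \<Longrightarrow> msubst \<sigma> A \<in> MS4"
  using mrule_closedD(2)[OF mrule_closed_MS4] .

lemma MS4_CPC_instance: "P \<in> CPC \<Longrightarrow> msubst \<sigma> (mfm_of_pfm P) \<in> MS4"
  using MS4_contains(1) MS4_subst by blast

abbreviation (input) inst3 :: "mfm \<Rightarrow> mfm \<Rightarrow> mfm \<Rightarrow> nat \<Rightarrow> mfm" where
  "inst3 A B C \<equiv> \<lambda>n. if n = 0 then A else if n = 1 then B else C"

lemma MS4_IPC_axioms:
  "A \<rightarrow>\<^sub>M B \<rightarrow>\<^sub>M A \<in> MS4"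
  "(A \<rightarrow>\<^sub>M B \<rightarrow>\<^sub>M C) \<rightarrow>\<^sub>M (A \<rightarrow>\<^sub>M B) \<rightarrow>\<^sub>M A \<rightarrow>\<^sub>M C \<in> MS4"
  "A \<and>\<^sub>M B \<rightarrow>\<^sub>M A \<in> MS4"
  "A \<and>\<^sub>M B \<rightarrow>\<^sub>M B \<in> MS4"
  "A \<rightarrow>\<^sub>M B \<rightarrow>\<^sub>M A \<and>\<^sub>M B \<in> MS4"
  "A \<rightarrow>\<^sub>M A \<or>\<^sub>M B \<in> MS4"
  "B \<rightarrow>\<^sub>M A \<or>\<^sub>M B \<in> MS4"
  "(A \<rightarrow>\<^sub>M C) \<rightarrow>\<^sub>M (B \<rightarrow>\<^sub>M C) \<rightarrow>\<^sub>M A \<or>\<^sub>M B \<rightarrow>\<^sub>M C \<in> MS4"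
  "\<bottom>\<^sub>M \<rightarrow>\<^sub>M A \<in> MS4"
  using IPC.intros(1,3-6)[of "PVar 0" "PVar 1", THEN CPC.ipc,
      THEN MS4_CPC_instance[where \<sigma> = "inst3 A B C"]]
    IPC.intros(2)[of "PVar 0" "PVar 1" "PVar 2", THEN CPC.ipc,
      THEN MS4_CPC_instance[where \<sigma> = "inst3 A B C"]]
    IPC.intros(8)[of "PVar 0" "PVar 2" "PVar 1", THEN CPC.ipc,
      THEN MS4_CPC_instance[where \<sigma> = "inst3 A B C"]]
    IPC.intros(7)[of "PVar 1" "PVar 0", THEN CPC.ipc,
      THEN MS4_CPC_instance[where \<sigma> = "inst3 A B C"]]
    IPC.intros(9)[of "PVar 0", THEN CPC.ipc,
      THEN MS4_CPC_instance[where \<sigma> = "inst3 A B C"]]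
  by simp_all

lemma MS4_dneg: "\<not>\<^sub>M (\<not>\<^sub>M A) \<rightarrow>\<^sub>M A \<in> MS4"
  using MS4_CPC_instance[OF CPC.dneg[of "PVar 0"], of "\<lambda>_. A"] by simp

lemma MS4_modal_axioms:
  "\<box>\<^sub>M (A \<rightarrow>\<^sub>M B) \<rightarrow>\<^sub>M \<box>\<^sub>M A \<rightarrow>\<^sub>M \<box>\<^sub>M B \<in> MS4"
  "\<box>\<^sub>M A \<rightarrow>\<^sub>M A \<in> MS4"
  "\<box>\<^sub>M A \<rightarrow>\<^sub>M \<box>\<^sub>M (\<box>\<^sub>M A) \<in> MS4"
  "\<forall>\<^sub>M (A \<rightarrow>\<^sub>M B) \<rightarrow>\<^sub>M \<forall>\<^sub>M A \<rightarrow>\<^sub>M \<forall>\<^sub>M B \<in> MS4"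
  "\<forall>\<^sub>M A \<rightarrow>\<^sub>M A \<in> MS4"
  "\<forall>\<^sub>M A \<rightarrow>\<^sub>M \<forall>\<^sub>M (\<forall>\<^sub>M A) \<in> MS4"
  "\<exists>\<^sub>M A \<rightarrow>\<^sub>M \<forall>\<^sub>M (\<exists>\<^sub>M A) \<in> MS4"
  "\<box>\<^sub>M (\<forall>\<^sub>M A) \<rightarrow>\<^sub>M \<forall>\<^sub>M (\<box>\<^sub>M A) \<in> MS4"
proof -
  have "msubst (inst3 A B A) ` MS4_axioms \<subseteq> MS4"
    using MS4_contains(2) MS4_subst by blast
  then show
    "\<box>\<^sub>M (A \<rightarrow>\<^sub>M B) \<rightarrow>\<^sub>M \<box>\<^sub>M A \<rightarrow>\<^sub>M \<box>\<^sub>M B \<in> MS4"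
    "\<box>\<^sub>M A \<rightarrow>\<^sub>M A \<in> MS4"
    "\<box>\<^sub>M A \<rightarrow>\<^sub>M \<box>\<^sub>M (\<box>\<^sub>M A) \<in> MS4"
    "\<forall>\<^sub>M (A \<rightarrow>\<^sub>M B) \<rightarrow>\<^sub>M \<forall>\<^sub>M A \<rightarrow>\<^sub>M \<forall>\<^sub>M B \<in> MS4"
    "\<forall>\<^sub>M A \<rightarrow>\<^sub>M A \<in> MS4"
    "\<forall>\<^sub>M A \<rightarrow>\<^sub>M \<forall>\<^sub>M (\<forall>\<^sub>M A) \<in> MS4"
    "\<exists>\<^sub>M A \<rightarrow>\<^sub>M \<forall>\<^sub>M (\<exists>\<^sub>M A) \<in> MS4"
    "\<box>\<^sub>M (\<forall>\<^sub>M A) \<rightarrow>\<^sub>M \<forall>\<^sub>M (\<box>\<^sub>M A) \<in> MS4"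
    by (simp_all add: MS4_axioms_def S4_axioms_def S5_axioms_def Let_def)
qed

text \<open>
  Theories are closed under modus ponens only and not under necessitation, since they are to be
  the sets of formulas true at a single point.
\<close>
definition theory_of_MS4 :: "mfm set \<Rightarrow> bool" where
  "theory_of_MS4 T \<longleftrightarrow> MS4 \<subseteq> T \<and> (\<forall>A B. A \<in> T \<longrightarrow> (A \<rightarrow>\<^sub>M B) \<in> T \<longrightarrow> B \<in> T)"

definition worlds :: "mfm set set" where
  "worlds = {T. theory_of_MS4 T \<and> \<bottom>\<^sub>M \<notin> T \<and> (\<forall>A. A \<in> T \<or> \<not>\<^sub>M A \<in> T)}"

lemma theory_mp: "theory_of_MS4 T \<Longrightarrow> (A \<rightarrow>\<^sub>M B) \<in> T \<Longrightarrow> A \<in> T \<Longrightarrow> B \<in> T"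
  unfolding theory_of_MS4_def by blast

lemma theory_MS4: "theory_of_MS4 T \<Longrightarrow> A \<in> MS4 \<Longrightarrow> A \<in> T"
  unfolding theory_of_MS4_def by blast

text \<open>
  The deduction theorem: the formulas implied by \<open>A\<close> within \<open>T\<close> form the theory generated by
  \<open>T\<close> and \<open>A\<close>.
\<close>
lemma theory_adjoin:
  assumes T: "theory_of_MS4 T"
  shows "theory_of_MS4 {B. (A \<rightarrow>\<^sub>M B) \<in> T}" (is "theory_of_MS4 ?U")
    and "T \<subseteq> {B. (A \<rightarrow>\<^sub>M B) \<in> T}" and "A \<in> {B. (A \<rightarrow>\<^sub>M B) \<in> T}"
proof -
  note ax = MS4_IPC_axioms(1,2)[THEN theory_MS4[OF T]]
  show sub: "T \<subseteq> ?U" by (intro subsetI CollectI) (rule theory_mp[OF T ax(1)])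
  have "C \<in> ?U" if "B \<in> ?U" "B \<rightarrow>\<^sub>M C \<in> ?U" for B C
    using theory_mp[OF T theory_mp[OF T ax(2), of A B C]] that by simp
  moreover have "MS4 \<subseteq> ?U" using sub theory_MS4[OF T] by blast
  ultimately show "theory_of_MS4 ?U" unfolding theory_of_MS4_def by blast
  have "A \<rightarrow>\<^sub>M A \<in> T"
    by (rule theory_mp[OF T theory_mp[OF T ax(2) ax(1)] ax(1)[of A A]])
  then show "A \<in> ?U" by simp
qed

text \<open>
  A consistent theory that is maximal among those containing \<open>T\<close> and \<open>\<not>A\<close> decides every
  formula, because a formula and its negation cannot both be inconsistent with it.
\<close>
lemma Lindenbaum:
  assumes T: "theory_of_MS4 T" and A: "A \<notin> T"
  obtains U where "U \<in> worlds" "T \<subseteq> U" "A \<notin> U"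
proof -
  define T0 where "T0 = {B. (\<not>\<^sub>M A \<rightarrow>\<^sub>M B) \<in> T}"
  have T0: "theory_of_MS4 T0" "T \<subseteq> T0" "\<not>\<^sub>M A \<in> T0"
    using theory_adjoin[OF T, of "\<not>\<^sub>M A"] unfolding T0_def by auto
  have bot: "\<bottom>\<^sub>M \<notin> T0"
    using A theory_mp[OF T theory_MS4[OF T MS4_dneg[of A]]] by (auto simp: T0_def)
  define F where "F = {U. theory_of_MS4 U \<and> T0 \<subseteq> U \<and> \<bottom>\<^sub>M \<notin> U}"
  have "T0 \<in> F" using T0 bot by (simp add: F_def)
  have "\<exists>U\<in>F. \<forall>Y\<in>F. U \<subseteq> Y \<longrightarrow> Y = U"
  proof (rule subset_Zorn_nonempty)
    show "F \<noteq> {}" using \<open>T0 \<in> F\<close> by blast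
    fix C assume C: "C \<noteq> {}" "subset.chain F C"
    have sub: "C \<subseteq> F" and lin: "\<And>X Y. X \<in> C \<Longrightarrow> Y \<in> C \<Longrightarrow> X \<subseteq> Y \<or> Y \<subseteq> X"
      using C(2) by (auto simp: subset.chain_def)
    have "B \<in> \<Union>C" if AB: "A \<in> \<Union>C" "A \<rightarrow>\<^sub>M B \<in> \<Union>C" for A B
    proof -
      obtain X Y where "X \<in> C" "A \<in> X" "Y \<in> C" "A \<rightarrow>\<^sub>M B \<in> Y" using AB by blast
      then obtain Z where "Z \<in> C" "A \<in> Z" "A \<rightarrow>\<^sub>M B \<in> Z" using lin by blast
      moreover have "theory_of_MS4 Z" using \<open>Z \<in> C\<close> sub by (auto simp: F_def)
      ultimately have "B \<in> Z" using theory_mp[of Z A B] by blast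
      then show ?thesis using \<open>Z \<in> C\<close> by blast
    qed
    moreover have "T0 \<subseteq> \<Union>C" "\<bottom>\<^sub>M \<notin> \<Union>C" using C(1) sub by (auto simp: F_def)
    moreover have "MS4 \<subseteq> \<Union>C" using \<open>T0 \<subseteq> \<Union>C\<close> theory_MS4[OF T0(1)] by blast
    ultimately have "theory_of_MS4 (\<Union>C)" unfolding theory_of_MS4_def by blast
    then show "\<Union>C \<in> F" using \<open>T0 \<subseteq> \<Union>C\<close> \<open>\<bottom>\<^sub>M \<notin> \<Union>C\<close> by (simp add: F_def)
  qed
  then obtain U where "U \<in> F" and max: "\<And>Y. Y \<in> F \<Longrightarrow> U \<subseteq> Y \<Longrightarrow> Y = U"
    by blast
  then have U: "theory_of_MS4 U" "T0 \<subseteq> U" "\<bottom>\<^sub>M \<notin> U" by (simp_all add: F_def)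
  have "\<not>\<^sub>M B \<in> U" if "B \<notin> U" for B
  proof (rule ccontr)
    assume "\<not>\<^sub>M B \<notin> U"
    then have "{C. (B \<rightarrow>\<^sub>M C) \<in> U} \<in> F"
      using theory_adjoin[OF U(1), of B] U(2) unfolding F_def by blast
    from max[OF this theory_adjoin(2)[OF U(1)]] show False
      using theory_adjoin(3)[OF U(1), of B] that by simp
  qed
  then have "U \<in> worlds" using U by (auto simp: worlds_def)
  moreover have "A \<notin> U" using U T0(3) theory_mp[of U A "\<bottom>\<^sub>M"] by blast
  ultimately show thesis using that T0(2) U(2) by blast
qed

lemma world_theory: "T \<in> worlds \<Longrightarrow> theory_of_MS4 T"
  by (simp add: worlds_def)

lemma world_MS4: "T \<in> worlds \<Longrightarrow> A \<in> MS4 \<Longrightarrow> A \<in> T"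
  by (rule theory_MS4[OF world_theory])

lemma world_bot: "T \<in> worlds \<Longrightarrow> \<bottom>\<^sub>M \<notin> T"
  by (simp add: worlds_def)

lemma world_imp: assumes T: "T \<in> worlds" shows "A \<rightarrow>\<^sub>M B \<in> T \<longleftrightarrow> (A \<in> T \<longrightarrow> B \<in> T)"
proof -
  note mp = theory_mp[OF world_theory[OF T]] and ax = MS4_IPC_axioms[THEN world_MS4[OF T]]
  have "A \<rightarrow>\<^sub>M B \<in> T" if "B \<in> T" using that by (rule mp[OF ax(1)])
  moreover have "A \<rightarrow>\<^sub>M B \<in> T" if "A \<notin> T"
  proof -
    have "A \<rightarrow>\<^sub>M \<bottom>\<^sub>M \<in> T" using T that by (auto simp: worlds_def)
    moreover have "A \<rightarrow>\<^sub>M \<bottom>\<^sub>M \<rightarrow>\<^sub>M B \<in> T" by (rule mp[OF ax(1) ax(9)])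
    ultimately show ?thesis using mp[OF mp[OF ax(2), of A "\<bottom>\<^sub>M" B]] by simp
  qed
  ultimately show ?thesis using mp[of A B] by blast
qed

lemma world_and: assumes T: "T \<in> worlds" shows "A \<and>\<^sub>M B \<in> T \<longleftrightarrow> A \<in> T \<and> B \<in> T"
  using MS4_IPC_axioms(3-5)[THEN world_MS4[OF T], of A B] unfolding world_imp[OF T] by blast

lemma world_or: assumes T: "T \<in> worlds" shows "A \<or>\<^sub>M B \<in> T \<longleftrightarrow> A \<in> T \<or> B \<in> T"
  using MS4_IPC_axioms(6)[THEN world_MS4[OF T], of A B] MS4_IPC_axioms(7)[THEN world_MS4[OF T], of B A]
    MS4_IPC_axioms(8)[THEN world_MS4[OF T], of A "\<bottom>\<^sub>M" B] world_bot[OF T]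
  unfolding world_imp[OF T] by blast

definition canonical_R :: "mfm set \<Rightarrow> mfm set \<Rightarrow> bool" where
  "canonical_R T U \<longleftrightarrow> U \<in> worlds \<and> (\<forall>A. \<box>\<^sub>M A \<in> T \<longrightarrow> A \<in> U)"

definition canonical_E :: "mfm set \<Rightarrow> mfm set \<Rightarrow> bool" where
  "canonical_E T U \<longleftrightarrow> U \<in> worlds \<and> (\<forall>A. \<forall>\<^sub>M A \<in> T \<longrightarrow> A \<in> U)"

lemma world_box: assumes T: "T \<in> worlds" shows "\<box>\<^sub>M A \<in> T \<longleftrightarrow> (\<forall>U. canonical_R T U \<longrightarrow> A \<in> U)"
proof
  assume succ: "\<forall>U. canonical_R T U \<longrightarrow> A \<in> U"
  have "\<box>\<^sub>M C \<in> T" if "\<box>\<^sub>M B \<in> T" "\<box>\<^sub>M (B \<rightarrow>\<^sub>M C) \<in> T" for B C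
    using that MS4_modal_axioms(1)[THEN world_MS4[OF T], of B C] by (simp add: world_imp[OF T])
  moreover have "MS4 \<subseteq> {B. \<box>\<^sub>M B \<in> T}"
    using mrule_closedD(3)[OF mrule_closed_MS4] world_MS4[OF T] by blast
  ultimately have thy: "theory_of_MS4 {B. \<box>\<^sub>M B \<in> T}"
    unfolding theory_of_MS4_def by blast
  show "\<box>\<^sub>M A \<in> T"
  proof (rule ccontr)
    assume "\<box>\<^sub>M A \<notin> T"
    then have "A \<notin> {B. \<box>\<^sub>M B \<in> T}" by simp
    then obtain U where "U \<in> worlds" "{B. \<box>\<^sub>M B \<in> T} \<subseteq> U" "A \<notin> U"
      using Lindenbaum[OF thy] by metis
    then show False using succ unfolding canonical_R_def by blast
  qed
qed (simp add: canonical_R_def)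

lemma world_all: assumes T: "T \<in> worlds" shows "\<forall>\<^sub>M A \<in> T \<longleftrightarrow> (\<forall>U. canonical_E T U \<longrightarrow> A \<in> U)"
proof
  assume succ: "\<forall>U. canonical_E T U \<longrightarrow> A \<in> U"
  have "\<forall>\<^sub>M C \<in> T" if "\<forall>\<^sub>M B \<in> T" "\<forall>\<^sub>M (B \<rightarrow>\<^sub>M C) \<in> T" for B C
    using that MS4_modal_axioms(4)[THEN world_MS4[OF T], of B C] by (simp add: world_imp[OF T])
  moreover have "MS4 \<subseteq> {B. \<forall>\<^sub>M B \<in> T}"
    using mrule_closedD(4)[OF mrule_closed_MS4] world_MS4[OF T] by blast
  ultimately have thy: "theory_of_MS4 {B. \<forall>\<^sub>M B \<in> T}"
    unfolding theory_of_MS4_def by blast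
  show "\<forall>\<^sub>M A \<in> T"
  proof (rule ccontr)
    assume "\<forall>\<^sub>M A \<notin> T"
    then have "A \<notin> {B. \<forall>\<^sub>M B \<in> T}" by simp
    then obtain U where "U \<in> worlds" "{B. \<forall>\<^sub>M B \<in> T} \<subseteq> U" "A \<notin> U"
      using Lindenbaum[OF thy] by metis
    then show False using succ unfolding canonical_E_def by blast
  qed
qed (simp add: canonical_E_def)

lemma canonical_E_sym: assumes T: "T \<in> worlds" and TU: "canonical_E T U" shows "canonical_E U T"
proof -
  have U: "U \<in> worlds" using TU by (simp add: canonical_E_def)
  have "A \<in> T" if A: "\<forall>\<^sub>M A \<in> U" for A
  proof (rule ccontr)
    assume "A \<notin> T"
    then have "\<exists>\<^sub>M (\<not>\<^sub>M A) \<in> T"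
      using MS4_modal_axioms(5)[THEN world_MS4[OF T], of "\<not>\<^sub>M (\<not>\<^sub>M A)"]
      by (simp add: world_imp[OF T] world_bot[OF T])
    then have "\<exists>\<^sub>M (\<not>\<^sub>M A) \<in> U"
      using MS4_modal_axioms(7)[THEN world_MS4[OF T]] TU unfolding canonical_E_def world_imp[OF T] by blast
    moreover have "\<forall>\<^sub>M (\<not>\<^sub>M (\<not>\<^sub>M A)) \<in> U"
      using A unfolding world_all[OF U] by (auto simp: canonical_E_def world_imp world_bot)
    ultimately show False by (simp add: world_imp[OF U] world_bot[OF U])
  qed
  then show ?thesis using T by (simp add: canonical_E_def)
qed

text \<open>
  Canonicity of \<open>\<box>\<forall>p \<rightarrow> \<forall>\<box>p\<close>. A world \<open>S\<close> with \<open>T R S E V\<close> has to contain all \<open>B\<close>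
  with \<open>\<box>B \<in> T\<close> and all \<open>\<forall>A \<in> V\<close>. If these were jointly inconsistent, then \<open>\<box>\<not>\<forall>A \<in> T\<close>
  for some \<open>\<forall>A \<in> V\<close>. By S5 this gives \<open>\<box>\<forall>\<not>\<forall>A \<in> T\<close>, hence \<open>\<forall>\<box>\<not>\<forall>A \<in> T\<close> by the axiom, and
  following \<open>E\<close> and \<open>R\<close> along \<open>U\<close> leads to \<open>\<not>\<forall>A \<in> V\<close>.
\<close>
lemma canonical_commute:
  assumes T: "T \<in> worlds" and TU: "canonical_E T U" and UV: "canonical_R U V"
  shows "\<exists>S. canonical_R T S \<and> canonical_E S V"
proof -
  have U: "U \<in> worlds" and V: "V \<in> worlds" using TU UV by (simp_all add: canonical_E_def canonical_R_def)
  \<comment> \<open>One premise \<open>\<forall>A\<close> suffices here, as \<open>\<forall>\<close> commutes with conjunction.\<close>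
  define T0 where "T0 = {C. \<exists>A. \<forall>\<^sub>M A \<in> V \<and> \<box>\<^sub>M (\<forall>\<^sub>M A \<rightarrow>\<^sub>M C) \<in> T}"
  have top: "\<forall>\<^sub>M (\<not>\<^sub>M \<bottom>\<^sub>M) \<in> V"
    unfolding world_all[OF V] by (simp add: canonical_E_def world_imp world_bot)
  have box: "C \<in> T0" if "\<box>\<^sub>M C \<in> T" for C
  proof -
    have "\<box>\<^sub>M (\<forall>\<^sub>M (\<not>\<^sub>M \<bottom>\<^sub>M) \<rightarrow>\<^sub>M C) \<in> T"
      using that unfolding world_box[OF T] by (auto simp: canonical_R_def world_imp)
    with top show ?thesis unfolding T0_def by blast
  qed
  have all: "\<forall>\<^sub>M A \<in> T0" if "\<forall>\<^sub>M A \<in> V" for A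
  proof -
    have "\<box>\<^sub>M (\<forall>\<^sub>M A \<rightarrow>\<^sub>M \<forall>\<^sub>M A) \<in> T"
      unfolding world_box[OF T] by (simp add: canonical_R_def world_imp)
    with that show ?thesis unfolding T0_def by blast
  qed
  have "D \<in> T0" if "C \<in> T0" and "C \<rightarrow>\<^sub>M D \<in> T0" for C D
  proof -
    obtain A where A: "\<forall>\<^sub>M A \<in> V" "\<box>\<^sub>M (\<forall>\<^sub>M A \<rightarrow>\<^sub>M C) \<in> T" using \<open>C \<in> T0\<close> by (auto simp: T0_def)
    obtain B where B: "\<forall>\<^sub>M B \<in> V" "\<box>\<^sub>M (\<forall>\<^sub>M B \<rightarrow>\<^sub>M C \<rightarrow>\<^sub>M D) \<in> T"
      using \<open>C \<rightarrow>\<^sub>M D \<in> T0\<close> by (auto simp: T0_def)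
    have conj: "\<forall>\<^sub>M (A \<and>\<^sub>M B) \<in> S \<longleftrightarrow> \<forall>\<^sub>M A \<in> S \<and> \<forall>\<^sub>M B \<in> S" if "S \<in> worlds" for S
      unfolding world_all[OF that] by (auto simp: canonical_E_def world_and)
    have "\<box>\<^sub>M (\<forall>\<^sub>M (A \<and>\<^sub>M B) \<rightarrow>\<^sub>M D) \<in> T"
      using A(2) B(2) unfolding world_box[OF T] by (auto simp: canonical_R_def world_imp conj)
    moreover have "\<forall>\<^sub>M (A \<and>\<^sub>M B) \<in> V" using A B conj[OF V] by blast
    ultimately show ?thesis by (auto simp: T0_def)
  qed
  moreover have "MS4 \<subseteq> T0"
    using box mrule_closedD(3)[OF mrule_closed_MS4] world_MS4[OF T] by blast
  ultimately have T0: "theory_of_MS4 T0" unfolding theory_of_MS4_def by blast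
  have "\<bottom>\<^sub>M \<notin> T0"
  proof
    assume "\<bottom>\<^sub>M \<in> T0"
    then obtain A where A: "\<forall>\<^sub>M A \<in> V" "\<box>\<^sub>M (\<not>\<^sub>M (\<forall>\<^sub>M A)) \<in> T" by (auto simp: T0_def)
    have neg: "\<forall>\<^sub>M (\<not>\<^sub>M (\<forall>\<^sub>M A)) \<in> S" if S: "S \<in> worlds" and "\<not>\<^sub>M (\<forall>\<^sub>M A) \<in> S" for S
    proof -
      have "\<forall>\<^sub>M A \<notin> S'" if "canonical_E S S'" for S'
      proof
        assume "\<forall>\<^sub>M A \<in> S'"
        moreover have S': "S' \<in> worlds" using that by (simp add: canonical_E_def)
        ultimately have "\<forall>\<^sub>M (\<forall>\<^sub>M A) \<in> S'"
          using MS4_modal_axioms(6)[THEN world_MS4[OF S']] unfolding world_imp[OF S'] by blast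
        then have "\<forall>\<^sub>M A \<in> S" using canonical_E_sym[OF S that] by (simp add: canonical_E_def)
        then show False using that \<open>\<not>\<^sub>M (\<forall>\<^sub>M A) \<in> S\<close> S by (simp add: world_imp world_bot)
      qed
      then show ?thesis unfolding world_all[OF S] by (auto simp: canonical_E_def world_imp)
    qed
    have "\<not>\<^sub>M (\<forall>\<^sub>M A) \<in> S" "S \<in> worlds" if "canonical_R T S" for S
      using A(2) that by (simp_all add: canonical_R_def)
    then have "\<box>\<^sub>M (\<forall>\<^sub>M (\<not>\<^sub>M (\<forall>\<^sub>M A))) \<in> T"
      using neg by (simp add: world_box[OF T])
    then have "\<forall>\<^sub>M (\<box>\<^sub>M (\<not>\<^sub>M (\<forall>\<^sub>M A))) \<in> T"
      using MS4_modal_axioms(8)[THEN world_MS4[OF T]] unfolding world_imp[OF T] by blast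
    then have "\<not>\<^sub>M (\<forall>\<^sub>M A) \<in> V" using TU UV by (simp add: canonical_E_def canonical_R_def)
    then show False using A(1) V by (simp add: world_imp world_bot)
  qed
  obtain S where S: "S \<in> worlds" "T0 \<subseteq> S" using Lindenbaum[OF T0 \<open>\<bottom>\<^sub>M \<notin> T0\<close>] by metis
  have "canonical_R T S" using box S by (auto simp: canonical_R_def)
  moreover have "canonical_E V S"
    using all S MS4_modal_axioms(5)[THEN world_MS4[OF S(1)]]
    unfolding world_imp[OF S(1)] canonical_E_def by blast
  ultimately show ?thesis using canonical_E_sym[OF V] by blast
qed

lemma MS4_frame_canonical: "MS4_frame worlds canonical_R canonical_E"
proof
  fix T U V assume T: "T \<in> worlds"
  show "canonical_R T T" "canonical_E T T"
    using MS4_modal_axioms(2,5)[THEN world_MS4[OF T]] T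
    unfolding world_imp[OF T] canonical_R_def canonical_E_def by blast+
  show "canonical_R T U \<Longrightarrow> U \<in> worlds" "canonical_E T U \<Longrightarrow> U \<in> worlds"
    by (simp_all add: canonical_R_def canonical_E_def)
  show "canonical_R T U \<Longrightarrow> canonical_R U V \<Longrightarrow> canonical_R T V" "canonical_E T U \<Longrightarrow> canonical_E U V \<Longrightarrow> canonical_E T V"
    using MS4_modal_axioms(3,6)[THEN world_MS4[OF T]]
    unfolding world_imp[OF T] canonical_R_def canonical_E_def by blast+
qed (use canonical_E_sym canonical_commute in blast)+

lemma truth:
  "T \<in> worlds \<Longrightarrow> sat canonical_R canonical_E (\<lambda>T n. MVar n \<in> T) A T \<longleftrightarrow> A \<in> T"
proof (induction A arbitrary: T)
  case (MBox A)
  have "U \<in> worlds" if "canonical_R T U" for U using that by (simp add: canonical_R_def)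
  then show ?case using MBox by (simp add: world_box[OF MBox.prems])
next
  case (MAll A)
  have "U \<in> worlds" if "canonical_E T U" for U using that by (simp add: canonical_E_def)
  then show ?case using MAll by (simp add: world_all[OF MAll.prems])
qed (simp_all add: world_bot world_and world_or world_imp)

text \<open>
  The frames range over sets of formulas because the worlds of the canonical frame are such sets.
\<close>
lemma MS4_complete:
  assumes "\<And>(W :: mfm set set) R E V w. MS4_frame W R E \<Longrightarrow> w \<in> W \<Longrightarrow> sat R E V A w"
  shows "A \<in> MS4"
proof (rule ccontr)
  assume "A \<notin> MS4"
  moreover have "theory_of_MS4 MS4"
    using mrule_closedD(1)[OF mrule_closed_MS4] unfolding theory_of_MS4_def by blast
  ultimately obtain T where "T \<in> worlds" "A \<notin> T" using Lindenbaum by metis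
  then show False using assms[OF MS4_frame_canonical] truth by blast
qed

section \<open>The Goedel translation embeds MIPC into MS4\<close>

context MS4_frame
begin

text \<open>
  The case of \<open>\<exists>\<close> is the only one that needs the commutation of \<open>E\<close> and \<open>R\<close>: an \<open>E\<close>-neighbour
  witnessing \<open>\<exists>A\<close> below has a successor that is an \<open>E\<close>-neighbour above.
\<close>
lemma goedel_persistent:
  "w \<in> W \<Longrightarrow> R w u \<Longrightarrow> sat R E V (goedel A) w \<Longrightarrow> sat R E V (goedel A) u"
proof (induction A arbitrary: w u)
  case (IEx A)
  then obtain x where x: "E w x" "sat R E V (goedel A) x" by auto
  then have xW: "x \<in> W" "E x w" using IEx.prems(1) E_closed E_sym by blast+
  then obtain y where y: "R x y" "E y u" using commute IEx.prems(2) by blast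
  then have "sat R E V (goedel A) y" "E u y" using IEx.IH xW x E_sym R_closed by blast+
  then show ?case by auto
qed (auto dest: R_trans)

lemma goedel_imp:
  "sat R E V (goedel (A \<rightarrow>\<^sub>I B)) w \<longleftrightarrow>
    (\<forall>u. R w u \<longrightarrow> sat R E V (goedel A) u \<longrightarrow> sat R E V (goedel B) u)"
  by auto

lemma goedel_ex:
  "sat R E V (goedel (\<exists>\<^sub>I A)) w \<longleftrightarrow> (\<exists>u. E w u \<and> sat R E V (goedel A) u)"
  by auto

lemma goedel_IPC_valid:
  "A \<in> IPC \<Longrightarrow> w \<in> W \<Longrightarrow> sat R E V (goedel (ifm_of_pfm A)) w"
proof (induction arbitrary: w rule: IPC.induct)
  case (S A B C)
  have "sat R E V (goedel (ifm_of_pfm C)) x"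
    if "R w u" "R u v" "R v x"
      and ABC: "\<And>y z. R u y \<Longrightarrow> sat R E V (goedel (ifm_of_pfm A)) y \<Longrightarrow> R y z \<Longrightarrow>
        sat R E V (goedel (ifm_of_pfm B)) z \<Longrightarrow> sat R E V (goedel (ifm_of_pfm C)) z"
      and AB: "\<And>y. R v y \<Longrightarrow> sat R E V (goedel (ifm_of_pfm A)) y \<Longrightarrow>
        sat R E V (goedel (ifm_of_pfm B)) y"
      and A: "sat R E V (goedel (ifm_of_pfm A)) x" for u v x
  proof -
    have "u \<in> W" "x \<in> W" using that S R_closed by blast+
    then have "R u x" "R x x" using that R_trans R_refl by blast+
    then show ?thesis using ABC AB A that by blast
  qed
  then show ?case by (simp add: goedel_imp del: goedel.simps(5))
next
  case (disjE A C B)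
  have "sat R E V (goedel (ifm_of_pfm C)) x"
    if "R w u" "R u v" "R v x"
      and "\<And>y. R u y \<Longrightarrow> sat R E V (goedel (ifm_of_pfm A)) y \<Longrightarrow> sat R E V (goedel (ifm_of_pfm C)) y"
      and "\<And>y. R v y \<Longrightarrow> sat R E V (goedel (ifm_of_pfm B)) y \<Longrightarrow> sat R E V (goedel (ifm_of_pfm C)) y"
      and "sat R E V (goedel (ifm_of_pfm A)) x \<or> sat R E V (goedel (ifm_of_pfm B)) x" for u v x
  proof -
    have "u \<in> W" using that disjE R_closed by blast
    then have "R u x" using that R_trans by blast
    then show ?thesis using that by blast
  qed
  then show ?case by (simp add: goedel_imp del: goedel.simps(5))
next
  case (mp A B)
  then show ?case using R_refl by (auto simp: goedel_imp simp del: goedel.simps)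
next
  case (K A B)
  then show ?case
    by (auto simp: goedel_imp simp del: goedel.simps dest: R_closed goedel_persistent)
next
  case (conjI A B)
  then show ?case
    by (auto simp: goedel_imp simp del: goedel.simps(5) dest: R_closed goedel_persistent)
qed (simp_all add: goedel_imp del: goedel.simps(5))

text \<open>
  The axiom \<open>\<forall>p \<rightarrow> \<forall>\<forall>p\<close> amounts to the transitivity of \<open>R ; E\<close>. For \<open>\<exists>\<forall>p \<rightarrow> \<forall>p\<close>, points in
  the same \<open>E\<close>-class reach the same points along \<open>R ; E\<close>. For \<open>\<exists>p \<rightarrow> \<forall>\<exists>p\<close>, a witness of \<open>\<exists>p\<close>
  is moved up into the class of any point reached along \<open>R ; E\<close> and still satisfies \<open>p\<close> by
  persistence. All three rest on the commutation of \<open>E\<close> and \<open>R\<close>.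
\<close>
lemma goedel_MIPC_axioms_valid:
  assumes A: "A \<in> MIPC_axioms" and w: "w \<in> W"
  shows "sat R E V (goedel A) w"
proof -
  let ?P = "sat R E V (goedel (IVar 0))"
  let ?AllP = "sat R E V (goedel (\<forall>\<^sub>I (IVar 0)))"
  have all: "sat R E V (goedel (\<forall>\<^sub>I B)) x \<longleftrightarrow> (\<forall>y z. R x y \<longrightarrow> E y z \<longrightarrow> sat R E V (goedel B) z)" for B x
    by auto
  have inst: "?P x" if "x \<in> W" "?AllP x" for x
    using that R_refl E_refl unfolding all by blast
  have all_all: "?AllP z" if "x \<in> W" "?AllP x" "R x y" "E y z" for x y z
  proof -
    have "?P v" if "R z s" "E s v" for s v
    proof -
      have "y \<in> W" using \<open>x \<in> W\<close> \<open>R x y\<close> R_closed by blast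
      then obtain u where u: "R y u" "E u s" using commute \<open>E y z\<close> \<open>R z s\<close> by blast
      then have "R x u" "E u v"
        using \<open>x \<in> W\<close> \<open>y \<in> W\<close> \<open>R x y\<close> \<open>E s v\<close> R_trans R_closed E_trans by blast+
      then show ?thesis using \<open>?AllP x\<close> unfolding all by blast
    qed
    then show ?thesis unfolding all by blast
  qed
  have ex_all: "?AllP x" if "x \<in> W" "E x y" "?AllP y" for x y
  proof -
    have y: "y \<in> W" "E y x" using that E_closed E_sym by blast+
    have "?P v" if "R x u" "E u v" for u v
    proof -
      obtain s where s: "R y s" "E s u" using commute y \<open>R x u\<close> by blast
      then have "E s v" using y \<open>E u v\<close> R_closed E_trans by blast
      then show ?thesis using \<open>?AllP y\<close> s unfolding all by blast
    qed
    then show ?thesis unfolding all by blast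
  qed
  have all_ex: "\<exists>s. E v s \<and> ?P s" if "x \<in> W" "E x y" "?P y" "R x u" "E u v" for x y u v
  proof -
    have y: "y \<in> W" "E y x" using that E_closed E_sym by blast+
    then obtain s where s: "R y s" "E s u" using commute \<open>R x u\<close> by blast
    have "u \<in> W" "v \<in> W" "s \<in> W" using that y s R_closed E_closed by blast+
    then have "E v u" "E u s" using that s E_sym by blast+
    then have "E v s" using \<open>v \<in> W\<close> E_trans by blast
    moreover have "?P s" using goedel_persistent y s that by blast
    ultimately show ?thesis by blast
  qed
  have all_conj: "sat R E V (goedel (\<forall>\<^sub>I (B \<and>\<^sub>I C))) x \<longleftrightarrow>
      sat R E V (goedel (\<forall>\<^sub>I B \<and>\<^sub>I \<forall>\<^sub>I C)) x" for B C x
    by auto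
  have ex_disj: "sat R E V (goedel (\<exists>\<^sub>I (B \<or>\<^sub>I C))) x \<longleftrightarrow>
      sat R E V (goedel (\<exists>\<^sub>I B \<or>\<^sub>I \<exists>\<^sub>I C)) x" for B C x
    by auto
  have conj: "sat R E V (goedel (B \<and>\<^sub>I C)) x \<longleftrightarrow>
      sat R E V (goedel B) x \<and> sat R E V (goedel C) x" for B C x
    by simp
  note sem = goedel_imp goedel_ex conj
  from A consider
      "A = \<forall>\<^sub>I (IVar 0 \<and>\<^sub>I IVar 1) \<leftrightarrow>\<^sub>I (\<forall>\<^sub>I (IVar 0) \<and>\<^sub>I \<forall>\<^sub>I (IVar 1))"
    | "A = \<forall>\<^sub>I (IVar 0) \<rightarrow>\<^sub>I IVar 0"
    | "A = \<forall>\<^sub>I (IVar 0) \<rightarrow>\<^sub>I \<forall>\<^sub>I (\<forall>\<^sub>I (IVar 0))"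
    | "A = \<exists>\<^sub>I (IVar 0 \<or>\<^sub>I IVar 1) \<leftrightarrow>\<^sub>I (\<exists>\<^sub>I (IVar 0) \<or>\<^sub>I \<exists>\<^sub>I (IVar 1))"
    | "A = IVar 0 \<rightarrow>\<^sub>I \<exists>\<^sub>I (IVar 0)"
    | "A = \<exists>\<^sub>I (\<exists>\<^sub>I (IVar 0)) \<rightarrow>\<^sub>I \<exists>\<^sub>I (IVar 0)"
    | "A = (\<exists>\<^sub>I (IVar 0) \<and>\<^sub>I \<exists>\<^sub>I (IVar 1)) \<rightarrow>\<^sub>I \<exists>\<^sub>I (\<exists>\<^sub>I (IVar 0) \<and>\<^sub>I IVar 1)"
    | "A = \<exists>\<^sub>I (\<forall>\<^sub>I (IVar 0)) \<leftrightarrow>\<^sub>I \<forall>\<^sub>I (IVar 0)"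
    | "A = \<exists>\<^sub>I (IVar 0) \<leftrightarrow>\<^sub>I \<forall>\<^sub>I (\<exists>\<^sub>I (IVar 0))"
    unfolding MIPC_axioms_def Let_def by blast
  then show ?thesis
  proof cases
    case 1 show ?thesis unfolding 1 conj goedel_imp all_conj by blast
  next
    case 2 show ?thesis unfolding 2 goedel_imp using inst w R_closed by blast
  next
    case 3
    show ?thesis unfolding 3 goedel_imp all[of "\<forall>\<^sub>I (IVar 0)"]
      using all_all w R_closed by blast
  next
    case 4 show ?thesis unfolding 4 conj goedel_imp ex_disj by blast
  next
    case 5 show ?thesis unfolding 5 sem using E_refl w R_closed by blast
  next
    case 6 show ?thesis unfolding 6 sem using E_trans w R_closed by blast
  next
    case 7
    have "E z y" if "x \<in> W" "E x y" "E x z" for x y z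
      using that E_sym E_trans E_closed by meson
    then show ?thesis unfolding 7 sem using w R_closed by blast
  next
    case 8
    show ?thesis unfolding 8 sem using ex_all E_refl w R_closed by blast
  next
    case 9
    have "\<exists>y. E x y \<and> ?P y" if "x \<in> W" "sat R E V (goedel (\<forall>\<^sub>I (\<exists>\<^sub>I (IVar 0)))) x" for x
      using that R_refl E_refl unfolding all goedel_ex by blast
    moreover have "sat R E V (goedel (\<forall>\<^sub>I (\<exists>\<^sub>I (IVar 0)))) x"
      if "x \<in> W" "E x y" "?P y" for x y
      using that all_ex unfolding all goedel_ex by blast
    ultimately show ?thesis unfolding 9 sem using w R_closed by blast
  qed
qed

text \<open>
  Translation turns a letter \<open>p\<close> into \<open>\<box>p\<close>, so that substituting after translating inserts
  \<open>\<box>(\<sigma> p)\<^sup>t\<close> where translating after substituting gives \<open>(\<sigma> p)\<^sup>t\<close>. By persistence they agree.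
\<close>
lemma goedel_isubst:
  "w \<in> W \<Longrightarrow> sat R E V (goedel (isubst \<sigma> A)) w \<longleftrightarrow>
    sat R E V (msubst (\<lambda>n. goedel (\<sigma> n)) (goedel A)) w"
proof (induction A arbitrary: w)
  case (IVar n)
  then show ?case using goedel_persistent[of w _ V "\<sigma> n"] R_refl by auto
next
  case (IAll A)
  have "v \<in> W" if "R w u" "E u v" for u v
    using that IAll.prems R_closed E_closed by blast
  then show ?case using IAll.IH by auto
qed (auto dest: R_closed E_closed)

end

lemma rho_in_Lambda_MIPC:
  assumes "M \<in> carrier \<Lambda>MGrz" shows "\<rho> M \<in> carrier \<Lambda>MIPC"
proof -
  have MS4: "MS4 \<subseteq> M" and closed: "mrule_closed M"
    using assms by (simp_all add: Lambda_MGrz_def MS4_extension_def)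
  note mp = mrule_closedD(1)[OF closed] and subst = mrule_closedD(2)[OF closed]
    and nec = mrule_closedD(3,4)[OF closed]
  have "goedel B \<in> M" if "goedel A \<in> M" "goedel (A \<rightarrow>\<^sub>I B) \<in> M" for A B
  proof -
    have "goedel (A \<rightarrow>\<^sub>I B) \<rightarrow>\<^sub>M goedel A \<rightarrow>\<^sub>M goedel B \<in> MS4"
      by (rule MS4_complete) (auto dest: MS4_frame.R_refl)
    then have "goedel (A \<rightarrow>\<^sub>I B) \<rightarrow>\<^sub>M goedel A \<rightarrow>\<^sub>M goedel B \<in> M" using MS4 by blast
    then show ?thesis using mp[OF that(1) mp[OF that(2)]] by blast
  qed
  moreover have "goedel (isubst \<sigma> A) \<in> M" if "goedel A \<in> M" for A \<sigma>
  proof -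
    have "msubst (\<lambda>n. goedel (\<sigma> n)) (goedel A) \<rightarrow>\<^sub>M goedel (isubst \<sigma> A) \<in> MS4"
      by (rule MS4_complete) (simp add: MS4_frame.goedel_isubst)
    then have "msubst (\<lambda>n. goedel (\<sigma> n)) (goedel A) \<rightarrow>\<^sub>M goedel (isubst \<sigma> A) \<in> M" using MS4 by blast
    then show ?thesis by (rule mp[OF subst[OF that]])
  qed
  moreover have "goedel (\<forall>\<^sub>I A) \<in> M" if "goedel A \<in> M" for A
    using nec that by simp
  ultimately have irule: "irule_closed (\<rho> M)"
    unfolding irule_closed_def rho_def by blast
  have "goedel (ifm_of_pfm A) \<in> MS4" if "A \<in> IPC" for A
    using that by (intro MS4_complete MS4_frame.goedel_IPC_valid)
  moreover have "goedel A \<in> MS4" if "A \<in> MIPC_axioms" for A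
    using that by (intro MS4_complete MS4_frame.goedel_MIPC_axioms_valid)
  ultimately have "ifm_of_pfm ` IPC \<subseteq> \<rho> M" "MIPC_axioms \<subseteq> \<rho> M"
    using MS4 by (auto simp: rho_def)
  with irule have "MIPC \<subseteq> \<rho> M" unfolding MIPC_def by (simp add: Inter_lower)
  with irule show ?thesis by (simp add: Lambda_MIPC_def)
qed

text \<open>
  The last two conditions replace the back condition of a bounded morphism for \<open>E\<close>, which would
  ask that an \<open>E'\<close>-neighbour \<open>y\<close> of \<open>f w\<close> be the image of an \<open>E\<close>-neighbour of \<open>w\<close>. For the
  translation \<open>\<box>\<forall>\<close> of \<open>\<forall>\<close> it is enough to reach a preimage of \<open>y\<close> from \<open>w\<close> along \<open>R ; E\<close>.
  For \<open>\<exists>\<close> it is enough that the image of some \<open>E\<close>-neighbour lies above \<open>y\<close>, because translated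
  formulas are persistent.
\<close>
lemma goedel_reflect:
  assumes "MS4_frame W R E" and "MS4_frame W' R' E'"
    and f: "\<And>w. w \<in> W \<Longrightarrow> f w \<in> W'"
    and R_forth: "\<And>w u. w \<in> W \<Longrightarrow> R w u \<Longrightarrow> R' (f w) (f u)"
    and R_back: "\<And>w y. w \<in> W \<Longrightarrow> R' (f w) y \<Longrightarrow> \<exists>u. R w u \<and> f u = y"
    and E_forth: "\<And>w u. w \<in> W \<Longrightarrow> E w u \<Longrightarrow> E' (f w) (f u)"
    and all_back: "\<And>w y. w \<in> W \<Longrightarrow> E' (f w) y \<Longrightarrow> \<exists>u v. R w u \<and> E u v \<and> f v = y"
    and ex_back: "\<And>w y. w \<in> W \<Longrightarrow> E' (f w) y \<Longrightarrow> \<exists>u. E w u \<and> R' y (f u)"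
  shows "w \<in> W \<Longrightarrow> sat R E (\<lambda>w. V (f w)) (goedel A) w \<longleftrightarrow> sat R' E' V (goedel A) (f w)"
proof (induction A arbitrary: w)
  interpret F: MS4_frame W R E by fact
  interpret F': MS4_frame W' R' E' by fact
  {
    case (IVar n)
    then show ?case using R_forth R_back by auto metis
  next
    case IBot
    then show ?case by simp
  next
    case (IAnd A B)
    then show ?case by simp
  next
    case (IOr A B)
    then show ?case by simp
  next
    case (IImp A B)
    then show ?case
      unfolding F.goedel_imp F'.goedel_imp using R_forth R_back F.R_closed by metis
  next
    case (IAll A)
    have "sat R' E' V (goedel A) z"
      if all: "\<And>u v. R w u \<Longrightarrow> E u v \<Longrightarrow> sat R E (\<lambda>w. V (f w)) (goedel A) v"
        and yz: "R' (f w) y" "E' y z" for y z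
    proof -
      obtain u where u: "R w u" "f u = y" using R_back IAll.prems yz by blast
      then obtain v v' where v: "R u v" "E v v'" "f v' = z"
        using all_back F.R_closed IAll.prems yz by blast
      then have "R w v" "v' \<in> W"
        using u IAll.prems F.R_trans F.R_closed F.E_closed by blast+
      then show ?thesis using IAll.IH all v by blast
    qed
    moreover have "sat R E (\<lambda>w. V (f w)) (goedel A) v"
      if all: "\<And>y z. R' (f w) y \<Longrightarrow> E' y z \<Longrightarrow> sat R' E' V (goedel A) z"
        and uv: "R w u" "E u v" for u v
    proof -
      have "u \<in> W" "v \<in> W" using uv IAll.prems F.R_closed F.E_closed by blast+
      then show ?thesis using all R_forth E_forth uv IAll by blast
    qed
    ultimately show ?case by auto
  next
    case (IEx A)
    have "\<exists>u. E w u \<and> sat R E (\<lambda>w. V (f w)) (goedel A) u"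
      if y: "E' (f w) y" "sat R' E' V (goedel A) y" for y
    proof -
      obtain u where u: "E w u" "R' y (f u)" using ex_back IEx.prems y by blast
      have "y \<in> W'" using f[OF IEx.prems] y F'.E_closed by blast
      then have "sat R' E' V (goedel A) (f u)" using F'.goedel_persistent u y by blast
      then show ?thesis using u IEx F.E_closed by blast
    qed
    then show ?case
      unfolding F.goedel_ex F'.goedel_ex using E_forth IEx F.E_closed by blast
  }
qed

section \<open>Two finite frames\<close>

datatype diamond = DRoot | DSide | DMid | DTop
datatype chain = CRoot | CMid | CTop

definition diamond_R :: "diamond \<Rightarrow> diamond \<Rightarrow> bool" where
  "diamond_R u v \<longleftrightarrow> u = v \<or> u = DRoot \<or> v = DTop"
definition diamond_E :: "diamond \<Rightarrow> diamond \<Rightarrow> bool" where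
  "diamond_E u v \<longleftrightarrow> u = v \<or> u \<in> {DMid, DTop} \<and> v \<in> {DMid, DTop}"
definition chain_R :: "chain \<Rightarrow> chain \<Rightarrow> bool" where
  "chain_R u v \<longleftrightarrow> u = v \<or> u = CRoot \<or> v = CTop"
definition chain_E :: "chain \<Rightarrow> chain \<Rightarrow> bool" where
  "chain_E u v \<longleftrightarrow> (u = CRoot \<longleftrightarrow> v = CRoot)"

lemma all_diamond: "(\<forall>u. P u) \<longleftrightarrow> P DRoot \<and> P DSide \<and> P DMid \<and> P DTop"
  by (metis diamond.exhaust)
lemma ex_diamond: "(\<exists>u. P u) \<longleftrightarrow> P DRoot \<or> P DSide \<or> P DMid \<or> P DTop"
  by (metis diamond.exhaust)
lemma all_chain: "(\<forall>u. P u) \<longleftrightarrow> P CRoot \<and> P CMid \<and> P CTop"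
  by (metis chain.exhaust)
lemma ex_chain: "(\<exists>u. P u) \<longleftrightarrow> P CRoot \<or> P CMid \<or> P CTop"
  by (metis chain.exhaust)

lemma UNIV_diamond: "UNIV = {DRoot, DSide, DMid, DTop}"
  by (auto intro: diamond.exhaust)
lemma UNIV_chain: "UNIV = {CRoot, CMid, CTop}"
  by (auto intro: chain.exhaust)

interpretation diamond: MS4_frame UNIV diamond_R diamond_E
  by (standard; auto simp: diamond_R_def diamond_E_def ex_diamond; metis diamond.exhaust)

interpretation chain: MS4_frame UNIV chain_R chain_E
  by (standard; auto simp: chain_R_def chain_E_def ex_chain; metis chain.exhaust)

abbreviation diamond_logic :: "mfm set" where
  "diamond_logic \<equiv> frame_logic UNIV diamond_R diamond_E"
abbreviation chain_logic :: "mfm set" where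
  "chain_logic \<equiv> frame_logic UNIV chain_R chain_E"

lemma diamond_logic_carrier: "diamond_logic \<in> carrier \<Lambda>MGrz"
  by (rule diamond.frame_logic_in_Lambda_MGrz) (auto simp: UNIV_diamond diamond_R_def)

lemma chain_logic_carrier: "chain_logic \<in> carrier \<Lambda>MGrz"
  by (rule chain.frame_logic_in_Lambda_MGrz) (auto simp: UNIV_chain chain_R_def)

text \<open>
  The class of \<open>DSide\<close> is mapped to \<open>CTop\<close> only, not onto the class of \<open>CTop\<close>. The missing point
  \<open>CMid\<close> is reached from \<open>DSide\<close> by going up to \<open>DTop\<close> and then along \<open>E\<close>.
\<close>
fun collapse :: "diamond \<Rightarrow> chain" where
  "collapse DRoot = CRoot"
| "collapse DSide = CTop"
| "collapse DMid = CMid"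
| "collapse DTop = CTop"

lemma rho_diamond_le_rho_chain: "\<rho> diamond_logic \<subseteq> \<rho> chain_logic"
proof
  fix A assume "A \<in> \<rho> diamond_logic"
  then have valid: "sat diamond_R diamond_E V (goedel A) w" for V w
    by (simp add: rho_def frame_logic_def)
  have reflect: "sat diamond_R diamond_E (\<lambda>w. V (collapse w)) (goedel A) w \<longleftrightarrow>
      sat chain_R chain_E V (goedel A) (collapse w)" for V w
  proof (rule goedel_reflect[OF diamond.MS4_frame_axioms chain.MS4_frame_axioms])
    fix w u y
    show "diamond_R w u \<Longrightarrow> chain_R (collapse w) (collapse u)"
      by (cases w; cases u) (auto simp: diamond_R_def chain_R_def)
    show "diamond_E w u \<Longrightarrow> chain_E (collapse w) (collapse u)"
      by (cases w; cases u) (auto simp: diamond_E_def chain_E_def)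
    show "chain_R (collapse w) y \<Longrightarrow> \<exists>u. diamond_R w u \<and> collapse u = y"
      by (cases w; cases y) (auto simp: diamond_R_def chain_R_def ex_diamond)
    show "chain_E (collapse w) y \<Longrightarrow> \<exists>u v. diamond_R w u \<and> diamond_E u v \<and> collapse v = y"
      by (cases w; cases y) (auto simp: diamond_R_def diamond_E_def chain_E_def ex_diamond)
    show "chain_E (collapse w) y \<Longrightarrow> \<exists>u. diamond_E w u \<and> chain_R y (collapse u)"
      by (cases w; cases y) (auto simp: chain_R_def diamond_E_def chain_E_def ex_diamond)
  qed simp_all
  have "sat chain_R chain_E V (goedel A) y" for V y
  proof -
    obtain w where "collapse w = y" by (cases y) (auto intro: collapse.simps)
    then show ?thesis using valid reflect by blast
  qed
  then show "A \<in> \<rho> chain_logic"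
    unfolding rho_def frame_logic_def by blast
qed

abbreviation MDia :: "mfm \<Rightarrow> mfm"  (\<open>\<diamond>\<^sub>M _\<close> [80] 80) where
  "\<diamond>\<^sub>M A \<equiv> \<not>\<^sub>M (\<box>\<^sub>M (\<not>\<^sub>M A))"

text \<open>
  Here \<open>p\<close>, \<open>q\<close> and \<open>r\<close> stand for the root, the middle and the top of the chain. Satisfying the
  formula takes three successive points with \<open>p\<close>, \<open>q\<close> and \<open>r\<close>, so in the diamond it can only be
  done at \<open>DRoot\<close>. Then \<open>DSide\<close> satisfies none of the three: not \<open>p\<close>, because two more successive
  points would have to lie above it, and neither \<open>q\<close> nor \<open>r\<close>, because its \<open>E\<close>-class would have
  to contain both.
\<close>
definition chain_diagram :: mfm where
  "chain_diagram = (let p = MVar 0; q = MVar 1; r = \<not>\<^sub>M p \<and>\<^sub>M \<not>\<^sub>M q in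
     p \<and>\<^sub>M \<box>\<^sub>M (p \<rightarrow>\<^sub>M \<diamond>\<^sub>M q) \<and>\<^sub>M \<box>\<^sub>M (q \<rightarrow>\<^sub>M \<not>\<^sub>M p \<and>\<^sub>M \<diamond>\<^sub>M r) \<and>\<^sub>M
     \<box>\<^sub>M (\<not>\<^sub>M p \<rightarrow>\<^sub>M \<exists>\<^sub>M q) \<and>\<^sub>M \<box>\<^sub>M (q \<rightarrow>\<^sub>M \<exists>\<^sub>M r))"

lemma chain_diagram_refuted_diamond: "\<not>\<^sub>M chain_diagram \<in> diamond_logic"
  by (auto simp: frame_logic_def chain_diagram_def Let_def all_diamond diamond_R_def diamond_E_def)

lemma chain_diagram_satisfied_chain: "\<not>\<^sub>M chain_diagram \<notin> chain_logic"
proof -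
  let ?V = "\<lambda>w n. (n = 0 \<and> w = CRoot) \<or> (n = 1 \<and> w = CMid)"
  have "sat chain_R chain_E ?V chain_diagram CRoot"
    by (simp add: chain_diagram_def Let_def all_chain chain_R_def chain_E_def)
  then show ?thesis by (fastforce simp: frame_logic_def)
qed

text \<open>
  In a poset, seen as an intuitionistic frame, this formula is valid precisely if no chain has more than two points.
\<close>
definition depth2 :: ifm where
  "depth2 = (let p = IVar 0; q = IVar 1 in q \<or>\<^sub>I (q \<rightarrow>\<^sub>I p \<or>\<^sub>I (p \<rightarrow>\<^sub>I \<bottom>\<^sub>I)))"

text \<open>
  If the translation of \<open>depth2\<close> fails at the root of the chain, then \<open>\<box>q\<close> holds exactly at the
  two upper points and \<open>\<box>p\<close> exactly at the top. The substitution describes the root as the point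
  where \<open>\<box>q\<close> fails, and the middle as the point where \<open>\<box>q\<close> holds and \<open>\<box>p\<close> fails.
\<close>
definition depth2_subst :: "nat \<Rightarrow> mfm" where
  "depth2_subst n = (let p = MVar 0; q = MVar 1 in
     if n = 0 then \<not>\<^sub>M (\<box>\<^sub>M q) else \<box>\<^sub>M q \<and>\<^sub>M \<not>\<^sub>M (\<box>\<^sub>M p))"

lemma depth2_if_not_chain_diagram:
  "\<not>\<^sub>M (msubst depth2_subst chain_diagram) \<rightarrow>\<^sub>M goedel depth2 \<in> chain_logic"
  by (auto simp: frame_logic_def chain_diagram_def depth2_def depth2_subst_def Let_def
      all_chain chain_R_def chain_E_def)

lemma depth2_not_in_rho_chain: "depth2 \<notin> \<rho> chain_logic"
proof -
  let ?V = "\<lambda>w n. (n = 0 \<and> w = CTop) \<or> (n = 1 \<and> w \<noteq> CRoot)"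
  have "\<not> sat chain_R chain_E ?V (goedel depth2) CRoot"
    by (simp add: depth2_def Let_def all_chain chain_R_def chain_E_def)
  then show ?thesis by (fastforce simp: rho_def frame_logic_def)
qed

section \<open>Failure of injectivity and of join preservation\<close>

lemma rho_not_inj: "\<not> inj_on \<rho> (carrier \<Lambda>MGrz)"
proof
  assume inj: "inj_on \<rho> (carrier \<Lambda>MGrz)"
  have "mrule_closed (\<Inter> {diamond_logic, chain_logic})"
    using diamond_logic_carrier chain_logic_carrier
    by (intro mrule_closed_Inter) (auto simp: Lambda_MGrz_def MS4_extension_def)
  then have "diamond_logic \<inter> chain_logic \<in> carrier \<Lambda>MGrz"
    using diamond_logic_carrier chain_logic_carrier by (auto simp: Lambda_MGrz_def MS4_extension_def)
  moreover have "\<rho> (diamond_logic \<inter> chain_logic) = \<rho> diamond_logic"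
    using rho_diamond_le_rho_chain by (auto simp: rho_def)
  ultimately have "diamond_logic \<inter> chain_logic = diamond_logic"
    using inj diamond_logic_carrier by (auto dest: inj_onD)
  then show False
    using chain_diagram_refuted_diamond chain_diagram_satisfied_chain by blast
qed

lemma rho_not_join_preserving: "\<not> join_pres \<Lambda>MGrz \<Lambda>MIPC \<rho>"
proof
  assume "join_pres \<Lambda>MGrz \<Lambda>MIPC \<rho>"
  then have join: "\<rho> (diamond_logic \<squnion>\<^bsub>\<Lambda>MGrz\<^esub> chain_logic) = \<rho> diamond_logic \<squnion>\<^bsub>\<Lambda>MIPC\<^esub> \<rho> chain_logic"
    using diamond_logic_carrier chain_logic_carrier by (simp add: join_pres_def)
  interpret G: complete_lattice \<Lambda>MGrz by (rule complete_lattice_Lambda_MGrz)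
  interpret I: complete_lattice \<Lambda>MIPC by (rule complete_lattice_Lambda_MIPC)
  let ?J = "diamond_logic \<squnion>\<^bsub>\<Lambda>MGrz\<^esub> chain_logic"
  have "?J \<in> carrier \<Lambda>MGrz"
    using diamond_logic_carrier chain_logic_carrier by simp
  then have closed: "mrule_closed ?J"
    by (simp add: Lambda_MGrz_def MS4_extension_def)
  have sub: "diamond_logic \<subseteq> ?J" "chain_logic \<subseteq> ?J"
    using G.join_left[OF diamond_logic_carrier chain_logic_carrier]
      G.join_right[OF diamond_logic_carrier chain_logic_carrier]
    by (simp_all add: Lambda_MGrz_def)
  have "\<not>\<^sub>M chain_diagram \<in> ?J"
    using chain_diagram_refuted_diamond sub by blast
  then have "msubst depth2_subst (\<not>\<^sub>M chain_diagram) \<in> ?J"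
    by (rule mrule_closedD(2)[OF closed])
  then have "\<not>\<^sub>M (msubst depth2_subst chain_diagram) \<in> ?J"
    by simp
  moreover have "\<not>\<^sub>M (msubst depth2_subst chain_diagram) \<rightarrow>\<^sub>M goedel depth2 \<in> ?J"
    using depth2_if_not_chain_diagram sub by blast
  ultimately have "goedel depth2 \<in> ?J"
    by (rule mrule_closedD(1)[OF closed])
  then have "depth2 \<in> \<rho> ?J"
    by (simp add: rho_def)
  moreover have "\<rho> diamond_logic \<squnion>\<^bsub>\<Lambda>MIPC\<^esub> \<rho> chain_logic = \<rho> chain_logic"
  proof -
    have "\<rho> diamond_logic \<sqsubseteq>\<^bsub>\<Lambda>MIPC\<^esub> \<rho> chain_logic"
      using rho_diamond_le_rho_chain by (simp add: Lambda_MIPC_def)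
    then show ?thesis
      by (subst (asm) I.le_iff_meet) (intro rho_in_Lambda_MIPC diamond_logic_carrier chain_logic_carrier)+
  qed
  ultimately show False using join depth2_not_in_rho_chain by simp
qed

theorem theorem6p18:
  shows "\<rho> \<in> carrier \<Lambda>MGrz \<rightarrow> carrier \<Lambda>MIPC \<and>
         \<rho> \<notin> lattice_hom \<Lambda>MGrz \<Lambda>MIPC \<and>
         \<not> inj_on \<rho> (carrier \<Lambda>MGrz)"
  using rho_in_Lambda_MIPC rho_not_join_preserving rho_not_inj
  by (auto simp: lattice_hom_def)

end
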